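(* Let $\mathbb{F}_q$ be a finite field with $q$ elements, $n\ge1$, $a_1,\dots,a_n\in\mathbb{F}_q^*$ and $b\in\mathbb{F}_q$. Let $$f(x_1,\dots,x_n)=\sum_{j=1}^n a_j x_1^{d_{1,j}}\cdots x_j^{d_{j,j}}-b\in\mathbb{F}_q[x_1,\dots,x_n]$$ be a triangular polynomial ($d_{j,j}>0$ for all $1\le j\le n$ and $d_{i,j}\ge0$ for all $1\le i<j\le n$), and let $$g(x_1,\dots,x_n)=a_1x_1^{e_1}+\dots+a_nx_n^{e_n}-b$$ be a diagonal polynomial with $e_1,\dots,e_n\in\mathbb{Z}_{>0}$. Then $f$ is totally $*$-equivalent to $g$ if the following two conditions hold: (i) for all $1\le j\le n$ there is $m_{j,j}\in\mathbb{Z}_{q-1}^*$ (a unit of $\mathbb{Z}_{q-1}=\mathbb{Z}/(q-1)\mathbb{Z}$) such that $d_{j,j}=m_{j,j}e_j$ in $\mathbb{Z}_{q-1}$; (ii) for all $1\le i<j\le n$ we have $\gcd(d_{j,j},q-1)\mid d_{i,j}$.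
   Context: For a polynomial $f=\sum_{j=1}^m a_jX^{D_j}\in\mathbb{F}_q[x_1,\dots,x_n]$ with all $a_j\neq 0$, $D_j=(d_{1j},\dots,d_{nj})\in\mathbb{Z}_{\ge0}^n$ and $X^{D_j}=x_1^{d_{1j}}\cdots x_n^{d_{nj}}$, the augmented degree matrix $\tilde D_f$ is the $(n+1)\times m$ matrix whose $j$-th column is $(1,d_{1j},\dots,d_{nj})^T$. The vector $(a_1,\dots,a_m)$ is the coefficient vector. For a triangular polynomial $\sum_{j=1}^n a_jX^{D_j}-b$ the monomials are ordered $X^{D_1},\dots,X^{D_n}$, followed, only if $b\ne0$, by the constant term with coefficient $-b$ and column $(1,0,\dots,0)^T$. Two polynomials $f,g$ are $*$-equivalent if they have the same coefficient vector and the congruence systems $\tilde D_f v^T\equiv 0\pmod{q-1}$ and $\tilde D_g v^T\equiv 0\pmod{q-1}$ have the same set of solutions $v$. For $1\le k\le n$ let $f_k(x_1,\dots,x_k)=f(x_1,\dots,x_k,0,\dots,0)\in\mathbb{F}_q[x_1,\dots,x_k]$. Polynomials $f,g\in\mathbb{F}_q[x_1,\dots,x_n]$ are totally $*$-equivalent if $f_k$ is $*$-equivalent to $g_k$ for all $1\le k\le n$. *)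

theory Defs
  imports "HOL-Library.Poly_Mapping" "HOL-Library.Cardinality" "HOL-Number_Theory.Cong"
    "Jordan_Normal_Form.Matrix"
begin

text \<open>
  Exponent vectors and multivariate polynomials over variables indexed by the naturals; a
  polynomial in \<open>x\<^sub>1, \<dots>, x\<^sub>n\<close> is one in which only the indices \<open>1, \<dots>, n\<close> occur.
\<close>

type_synonym expvec = "nat \<Rightarrow>\<^sub>0 nat"
type_synonym 'a mvpoly = "expvec \<Rightarrow>\<^sub>0 'a"

definition mvar :: "nat \<Rightarrow> 'a::comm_semiring_1 mvpoly" where
  "mvar i = Poly_Mapping.single (Poly_Mapping.single i 1) 1"

definition mconst :: "'a::comm_semiring_1 \<Rightarrow> 'a mvpoly" where
  "mconst c = Poly_Mapping.single 0 c"

definition mvsubst :: "(nat \<Rightarrow> 'a mvpoly) \<Rightarrow> 'a mvpoly \<Rightarrow> 'a::comm_semiring_1 mvpoly" where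
  "mvsubst \<phi> p = (\<Sum>D\<in>Poly_Mapping.keys p. mconst (Poly_Mapping.lookup p D) *
     (\<Prod>i\<in>Poly_Mapping.keys D. \<phi> i ^ Poly_Mapping.lookup D i))"

definition restrict_vars :: "nat \<Rightarrow> 'a::comm_semiring_1 mvpoly \<Rightarrow> 'a mvpoly" where
  "restrict_vars k = mvsubst (\<lambda>i. if i \<le> k then mvar i else 0)"

text \<open>
  Coefficient vectors and degree matrices depend on the order in which the monomials of a
  polynomial are written. This order is given by a list \<open>Ds\<close> without repetitions which contains
  at least the monomials of the polynomial; entries with coefficient zero are skipped. Thus a
  single list orders the monomials of \<open>p\<close> and of all \<open>restrict_vars k p\<close>
  (see \<open>keys_restrict_vars\<close> below), and a constant term is listed only if it is nonzero.
\<close>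

definition ordered_monomials :: "expvec list \<Rightarrow> 'a::zero mvpoly \<Rightarrow> expvec list" where
  "ordered_monomials Ds p = filter (\<lambda>D. D \<in> Poly_Mapping.keys p) Ds"

definition coeff_vector :: "expvec list \<Rightarrow> 'a::zero mvpoly \<Rightarrow> 'a list" where
  "coeff_vector Ds p = map (Poly_Mapping.lookup p) (ordered_monomials Ds p)"

definition aug_degree_mat :: "nat \<Rightarrow> expvec list \<Rightarrow> 'a::zero mvpoly \<Rightarrow> int mat" where
  "aug_degree_mat k Ds p = (let Ms = ordered_monomials Ds p in
     mat (k + 1) (length Ms)
       (\<lambda>(i, j). if i = 0 then 1 else int (Poly_Mapping.lookup (Ms ! j) i)))"

definition cong_kernel :: "int \<Rightarrow> int mat \<Rightarrow> int vec set" where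
  "cong_kernel N A = {v \<in> carrier_vec (dim_col A). \<forall>i<dim_row A. [(A *\<^sub>v v) $ i = 0] (mod N)}"

definition star_equiv ::
  "nat \<Rightarrow> expvec list \<Rightarrow> 'a::{field,finite} mvpoly \<Rightarrow> expvec list \<Rightarrow> 'a mvpoly \<Rightarrow> bool" where
  "star_equiv k Ds f Es g \<longleftrightarrow>
     coeff_vector Ds f = coeff_vector Es g \<and>
     cong_kernel (int (CARD('a) - 1)) (aug_degree_mat k Ds f) =
     cong_kernel (int (CARD('a) - 1)) (aug_degree_mat k Es g)"

definition totally_star_equiv ::
  "nat \<Rightarrow> expvec list \<Rightarrow> 'a::{field,finite} mvpoly \<Rightarrow> expvec list \<Rightarrow> 'a mvpoly \<Rightarrow> bool" where
  "totally_star_equiv n Ds f Es g \<longleftrightarrow>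
     (\<forall>k\<in>{1..n}. star_equiv k Ds (restrict_vars k f) Es (restrict_vars k g))"

text \<open>
  The monomials of a triangular polynomial are written in the order \<open>D 1, \<dots>, D n\<close>, followed by
  the constant term. In \<open>d i j\<close> the first index is the variable and the second one the monomial.
\<close>

definition tri_exp :: "(nat \<Rightarrow> nat \<Rightarrow> nat) \<Rightarrow> nat \<Rightarrow> expvec" where
  "tri_exp d j = (\<Sum>i=1..j. Poly_Mapping.single i (d i j))"

definition diag_exp :: "(nat \<Rightarrow> nat) \<Rightarrow> nat \<Rightarrow> expvec" where
  "diag_exp e j = Poly_Mapping.single j (e j)"

definition tri_order :: "nat \<Rightarrow> (nat \<Rightarrow> expvec) \<Rightarrow> expvec list" where
  "tri_order n D = map D [1..<n + 1] @ [0]"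

definition unit_mod :: "nat \<Rightarrow> nat \<Rightarrow> bool" where
  "unit_mod N m \<longleftrightarrow> (\<exists>m'. [m * m' = 1] (mod N))"

text \<open>The lists used for ordering are indeed enumerations of the monomials.\<close>

lemma keys_sum_subset:
  "Poly_Mapping.keys (sum f A) \<subseteq> (\<Union>a\<in>A. Poly_Mapping.keys (f a))"
  by (induction A rule: infinite_finite_induct)
     (auto dest!: subsetD[OF Poly_Mapping.keys_add])

lemma mvar_power: "mvar i ^ m = Poly_Mapping.single (Poly_Mapping.single i m) (1::'a::comm_semiring_1)"
  by (induction m) (simp_all add: mvar_def mult_single flip: single_add)

lemma prod_single_one:
  "(\<Prod>i\<in>I. Poly_Mapping.single (h i) (1::'a::comm_semiring_1)) = Poly_Mapping.single (\<Sum>i\<in>I. h i) 1"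
  by (induction I rule: infinite_finite_induct) (simp_all add: mult_single)

lemma expvec_eq_sum:
  "(\<Sum>i\<in>Poly_Mapping.keys D. Poly_Mapping.single i (Poly_Mapping.lookup D i)) = (D :: expvec)"
  by (rule poly_mapping_eqI)
     (simp add: lookup_sum lookup_single when_def in_keys_iff)

lemma keys_restrict_vars: "Poly_Mapping.keys (restrict_vars k p) \<subseteq> Poly_Mapping.keys p"
proof -
  have "Poly_Mapping.keys (mconst (Poly_Mapping.lookup p D) *
      (\<Prod>i\<in>Poly_Mapping.keys D. (if i \<le> k then mvar i else 0) ^ Poly_Mapping.lookup D i)) \<subseteq> {D}"
    (is "Poly_Mapping.keys (_ * ?P) \<subseteq> _") for D
  proof (cases "\<forall>i\<in>Poly_Mapping.keys D. i \<le> k")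
    case True
    then have "?P = (\<Prod>i\<in>Poly_Mapping.keys D. mvar i ^ Poly_Mapping.lookup D i)"
      by (intro prod.cong) auto
    then have "?P = Poly_Mapping.single D 1"
      by (simp add: mvar_power prod_single_one expvec_eq_sum)
    then show ?thesis by (simp add: mconst_def mult_single)
  next
    case False
    then obtain i where i: "i \<in> Poly_Mapping.keys D" "\<not> i \<le> k" by blast
    then have "(if i \<le> k then mvar i else 0 :: 'a mvpoly) ^ Poly_Mapping.lookup D i = 0"
      by (simp add: in_keys_iff zero_power)
    with i(1) have "?P = 0" by (intro prod_zero bexI[of _ i] finite_keys)
    then show ?thesis by simp
  qed
  then show ?thesis
    unfolding restrict_vars_def mvsubst_def
    by (intro order.trans[OF keys_sum_subset]) blast
qed

lemma lookup_tri_exp: "Poly_Mapping.lookup (tri_exp d j) i = (if i \<in> {1..j} then d i j else 0)"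
  by (simp add: tri_exp_def lookup_sum lookup_single when_def)

lemma diag_exp_eq_tri_exp:
  assumes "1 \<le> j"
  shows "diag_exp e j = tri_exp (\<lambda>i j. if i = j then e j else 0) j"
  using assms by (intro poly_mapping_eqI) (auto simp: lookup_tri_exp diag_exp_def lookup_single when_def)

lemma distinct_tri_order:
  assumes "\<forall>j\<in>{1..n}. 0 < d j j"
  shows "distinct (tri_order n (tri_exp d))"
proof -
  have *: "tri_exp d i \<noteq> tri_exp d j" if "i < j" "j \<in> {1..n}" for i j
  proof
    assume "tri_exp d i = tri_exp d j"
    then have "Poly_Mapping.lookup (tri_exp d i) j = Poly_Mapping.lookup (tri_exp d j) j" by simp
    with that(1,2) have "d j j = 0" by (simp add: lookup_tri_exp)
    with bspec[OF assms that(2)] show False by simp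
  qed
  have "inj_on (tri_exp d) {1..<n + 1}"
    by (intro linorder_inj_onI) (use * in auto)
  moreover have "tri_exp d j \<noteq> 0" if "j \<in> {1..n}" for j
    using *[of 0 j] that by (simp add: tri_exp_def)
  then have "0 \<notin> tri_exp d ` {1..<n + 1}" by fastforce
  ultimately show ?thesis
    by (simp only: tri_order_def distinct_append distinct_map distinct_upt set_map set_upt) simp
qed

lemma keys_tri_poly:
  fixes a :: "nat \<Rightarrow> 'a::comm_ring_1"
  shows "Poly_Mapping.keys ((\<Sum>j=1..n. mconst (a j) * (\<Prod>i=1..j. mvar i ^ d i j)) - mconst b)
    \<subseteq> set (tri_order n (tri_exp d))"
proof -
  have "mconst (a j) * (\<Prod>i=1..j. mvar i ^ d i j) = Poly_Mapping.single (tri_exp d j) (a j)" for j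
    by (simp add: mconst_def mvar_power prod_single_one tri_exp_def mult_single)
  moreover have "Poly_Mapping.keys (\<Sum>j=1..n. Poly_Mapping.single (tri_exp d j) (a j))
      \<subseteq> tri_exp d ` {1..n}"
    by (rule order.trans[OF keys_sum_subset]) (auto split: if_splits)
  moreover have "set (tri_order n (tri_exp d)) = insert 0 (tri_exp d ` {1..n})"
    by (simp only: tri_order_def set_append set_map set_upt
        atLeastLessThanSuc_atLeastAtMost Suc_eq_plus1[symmetric]) simp
  ultimately show ?thesis
    by (auto simp: mconst_def simp del: One_nat_def
        dest!: subsetD[OF keys_diff] split: if_splits)
qed

end

(* Restricting a triangular polynomial to its first k variables keeps exactly its first k
   monomials and the constant term, so its degree matrix is upper triangular below the row of
   ones. If each diagonal entry satisfies gcd (d j j) N dvd d i j for i < j, then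
   N dvd d j j * v j forces N dvd d i j * v j; back substitution from the last row therefore
   decouples the congruence system into the conditions N dvd d j j * v j. These are unchanged
   when d j j is replaced by a unit multiple modulo N, which turns the system of f into that
   of g, itself a triangular polynomial with zeros above the diagonal. *)
theory Submission
  imports Defs
begin

section \<open>Coefficients after setting variables to zero\<close>

text \<open>The substitution either fixes a term or kills it, the latter as soon as a variable
  beyond \<open>k\<close> occurs. Hence no two terms can merge, and coefficients are read off term
  by term.\<close>

lemma lookup_restrict_vars:
  "Poly_Mapping.lookup (restrict_vars k p) D =
     (if Poly_Mapping.keys D \<subseteq> {..k} then Poly_Mapping.lookup p D else 0)"
proof -
  have "mconst (Poly_Mapping.lookup p D) *
      (\<Prod>i\<in>Poly_Mapping.keys D. (if i \<le> k then mvar i else 0) ^ Poly_Mapping.lookup D i) =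
      (if Poly_Mapping.keys D \<subseteq> {..k} then Poly_Mapping.single D (Poly_Mapping.lookup p D) else 0)"
    (is "_ * ?P D = _") for D
  proof (cases "Poly_Mapping.keys D \<subseteq> {..k}")
    case True
    then have "?P D = (\<Prod>i\<in>Poly_Mapping.keys D. mvar i ^ Poly_Mapping.lookup D i)"
      by (intro prod.cong) auto
    then have "?P D = Poly_Mapping.single D 1"
      by (simp add: mvar_power prod_single_one expvec_eq_sum)
    with True show ?thesis by (simp add: mconst_def mult_single)
  next
    case False
    then obtain i where i: "i \<in> Poly_Mapping.keys D" "\<not> i \<le> k" by blast
    then have "(if i \<le> k then mvar i else 0 :: 'a mvpoly) ^ Poly_Mapping.lookup D i = 0"
      by (simp add: in_keys_iff zero_power)
    with i(1) have "?P D = 0" by (intro prod_zero bexI[of _ i] finite_keys)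
    with False show ?thesis by simp
  qed
  then have "Poly_Mapping.lookup (restrict_vars k p) D =
      (\<Sum>E\<in>Poly_Mapping.keys p. Poly_Mapping.lookup
        (if Poly_Mapping.keys E \<subseteq> {..k} then Poly_Mapping.single E (Poly_Mapping.lookup p E) else 0) D)"
    by (simp add: restrict_vars_def mvsubst_def lookup_sum)
  also have "\<dots> = (\<Sum>E\<in>Poly_Mapping.keys p. if E = D then
      (if Poly_Mapping.keys D \<subseteq> {..k} then Poly_Mapping.lookup p D else 0) else 0)"
    by (intro sum.cong) (auto simp: lookup_single when_def)
  \<comment> \<open>If \<open>D\<close> is not a monomial of \<open>p\<close>, the sum is empty of
    contributions, but then \<open>lookup p D\<close> is zero as well.\<close>
  also have "\<dots> = (if Poly_Mapping.keys D \<subseteq> {..k} then Poly_Mapping.lookup p D else 0)"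
    by (simp add: in_keys_iff)
  finally show ?thesis .
qed

text \<open>The largest variable of the \<open>j\<close>-th monomial is the \<open>j\<close>-th one,
  since its exponent \<open>d j j\<close> is positive. This decides which monomials survive
  restriction.\<close>

lemma keys_tri_exp_subset_iff:
  assumes "1 \<le> j" "0 < d j j"
  shows "Poly_Mapping.keys (tri_exp d j) \<subseteq> {..k} \<longleftrightarrow> j \<le> k"
proof
  assume "Poly_Mapping.keys (tri_exp d j) \<subseteq> {..k}"
  moreover have "j \<in> Poly_Mapping.keys (tri_exp d j)"
    using assms by (simp add: in_keys_iff lookup_tri_exp)
  ultimately show "j \<le> k" by blast
qed (auto simp: in_keys_iff lookup_tri_exp split: if_splits)

section \<open>Triangular and diagonal polynomials in a common form\<close>

definition tri_poly :: "nat \<Rightarrow> (nat \<Rightarrow> 'a) \<Rightarrow> (nat \<Rightarrow> nat \<Rightarrow> nat) \<Rightarrow> 'a \<Rightarrow> 'a::comm_ring_1 mvpoly" where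
  "tri_poly n a d b = (\<Sum>j=1..n. mconst (a j) * (\<Prod>i=1..j. mvar i ^ d i j)) - mconst b"

lemma tri_poly_eq_singles:
  "tri_poly n a d b =
     (\<Sum>j=1..n. Poly_Mapping.single (tri_exp d j) (a j)) - Poly_Mapping.single 0 b"
  by (simp add: tri_poly_def mconst_def mvar_power prod_single_one tri_exp_def mult_single)

text \<open>Exponent table that makes a diagonal polynomial an instance of \<open>tri_poly\<close>,
  so that everything shown for f applies to g.\<close>

definition diag_mat :: "(nat \<Rightarrow> nat) \<Rightarrow> nat \<Rightarrow> nat \<Rightarrow> nat" where
  "diag_mat e i j = (if i = j then e j else 0)"

lemma diag_mat_simps [simp]: "diag_mat e j j = e j" "i \<noteq> j \<Longrightarrow> diag_mat e i j = 0"
  by (simp_all add: diag_mat_def)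

lemma diag_exp_eq_tri_exp_diag_mat:
  assumes "1 \<le> j"
  shows "diag_exp e j = tri_exp (diag_mat e) j"
  using diag_exp_eq_tri_exp[OF assms, of e] by (simp add: diag_mat_def[abs_def])

lemma tri_order_diag_exp: "tri_order n (diag_exp e) = tri_order n (tri_exp (diag_mat e))"
  by (auto simp: tri_order_def diag_exp_eq_tri_exp_diag_mat simp del: upt_Suc)

lemma diag_poly_eq_tri_poly:
  "(\<Sum>j=1..n. mconst (a j) * mvar j ^ e j) - mconst b = tri_poly n a (diag_mat e) b"
  unfolding tri_poly_eq_singles
  by (intro arg_cong2[where f = minus] sum.cong)
    (auto simp: mconst_def mvar_power mult_single diag_exp_def
      simp flip: diag_exp_eq_tri_exp_diag_mat)

section \<open>Monomials and coefficients of a triangular polynomial\<close>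

context
  fixes n :: nat and d :: "nat \<Rightarrow> nat \<Rightarrow> nat"
  assumes diag_pos: "\<forall>j\<in>{1..n}. 0 < d j j"
begin

lemma tri_exp_eq_iff:
  assumes "i \<in> {1..n}" "j \<in> {1..n}"
  shows "tri_exp d i = tri_exp d j \<longleftrightarrow> i = j"
proof -
  have "inj_on (tri_exp d) {1..n}"
    using distinct_tri_order[of n d, OF diag_pos]
    by (simp add: tri_order_def distinct_map atLeastLessThanSuc_atLeastAtMost del: upt_Suc)
  with assms show ?thesis by (simp add: inj_on_eq_iff)
qed

lemma tri_exp_neq_0:
  assumes "j \<in> {1..n}"
  shows "tri_exp d j \<noteq> 0"
proof
  assume "tri_exp d j = 0"
  then have "Poly_Mapping.lookup (tri_exp d j) j = 0" by simp
  moreover have "0 < d j j" using assms diag_pos by blast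
  ultimately show False using assms by (simp add: lookup_tri_exp)
qed

text \<open>By positivity of the diagonal, the monomials differ from each other and from the
  constant one, so no coefficient collects two terms.\<close>

lemma lookup_tri_poly:
  fixes a :: "nat \<Rightarrow> 'a::comm_ring_1"
  assumes "j \<in> {1..n}"
  shows "Poly_Mapping.lookup (tri_poly n a d b) (tri_exp d j) = a j"
proof -
  have "Poly_Mapping.lookup (tri_poly n a d b) (tri_exp d j) = (\<Sum>i=1..n. if i = j then a i else 0)"
    using assms
    by (auto simp: tri_poly_eq_singles lookup_minus lookup_sum lookup_single when_def
        tri_exp_eq_iff tri_exp_neq_0[OF assms, symmetric] intro!: sum.cong)
  with assms show ?thesis by simp
qed

lemma lookup_tri_poly_0: "Poly_Mapping.lookup (tri_poly n a d b) 0 = - b"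
proof -
  have "(\<Sum>j=1..n. Poly_Mapping.lookup (Poly_Mapping.single (tri_exp d j) (a j)) 0) = 0"
    using tri_exp_neq_0 by (intro sum.neutral) (auto simp: lookup_single when_def)
  then show ?thesis by (simp add: tri_poly_eq_singles lookup_minus lookup_sum)
qed

lemma lookup_restrict_tri_poly:
  assumes "j \<in> {1..n}"
  shows "Poly_Mapping.lookup (restrict_vars k (tri_poly n a d b)) (tri_exp d j) =
    (if j \<le> k then a j else 0)"
proof -
  have "Poly_Mapping.keys (tri_exp d j) \<subseteq> {..k} \<longleftrightarrow> j \<le> k"
    using assms diag_pos by (intro keys_tri_exp_subset_iff) auto
  with assms show ?thesis by (simp add: lookup_restrict_vars lookup_tri_poly)
qed

lemma lookup_restrict_tri_poly_0:
  "Poly_Mapping.lookup (restrict_vars k (tri_poly n a d b)) 0 = - b"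
  by (simp add: lookup_restrict_vars lookup_tri_poly_0)

context
  fixes k :: nat
  assumes k_le: "k \<le> n"
begin

text \<open>As all \<open>a j\<close> are nonzero, a nonconstant monomial is skipped only if
  restriction kills it. The constant term survives every restriction.\<close>

lemma ordered_monomials_restrict_tri_poly:
  assumes "\<forall>j\<in>{1..n}. a j \<noteq> 0"
  shows "ordered_monomials (tri_order n (tri_exp d)) (restrict_vars k (tri_poly n a d b)) =
    map (tri_exp d) [1..<k + 1] @ (if b = 0 then [] else [0])"
proof -
  let ?P = "\<lambda>D. D \<in> Poly_Mapping.keys (restrict_vars k (tri_poly n a d b))"
  have upt: "[1..<n + 1] = [1..<k + 1] @ [k + 1..<n + 1]"
    using upt_add_eq_append[of 1 "k + 1" "n - k"] k_le by simp
  have "?P (tri_exp d j) \<longleftrightarrow> j \<le> k" if "j \<in> {1..n}" for j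
    unfolding in_keys_iff lookup_restrict_tri_poly[OF that] using assms that by simp
  then have "filter (?P \<circ> tri_exp d) [1..<k + 1] = [1..<k + 1]"
    and "filter (?P \<circ> tri_exp d) [k + 1..<n + 1] = []"
    using k_le by (auto simp: filter_id_conv filter_empty_conv simp del: upt_Suc)
  then have "filter ?P (map (tri_exp d) [1..<n + 1]) = map (tri_exp d) [1..<k + 1]"
    by (simp only: upt filter_map filter_append append_Nil2)
  moreover have "?P 0 \<longleftrightarrow> b \<noteq> 0"
    by (simp add: in_keys_iff lookup_restrict_tri_poly_0)
  ultimately show ?thesis
    by (simp add: ordered_monomials_def tri_order_def del: upt_Suc)
qed

text \<open>The right-hand side is free of \<open>d\<close>, which settles the coefficient half of
  the equivalence of f and g.\<close>

lemma coeff_vector_restrict_tri_poly: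
  assumes "\<forall>j\<in>{1..n}. a j \<noteq> 0"
  shows "coeff_vector (tri_order n (tri_exp d)) (restrict_vars k (tri_poly n a d b)) =
    map a [1..<k + 1] @ (if b = 0 then [] else [- b])"
  using k_le
  by (auto simp: coeff_vector_def ordered_monomials_restrict_tri_poly[OF assms]
      lookup_restrict_tri_poly lookup_restrict_tri_poly_0 simp del: upt_Suc)

end

end

section \<open>Solutions of the congruence systems\<close>

text \<open>\<open>N\<close> divides both \<open>c * x\<close> and \<open>N * x\<close>, hence their
  gcd, which is \<open>gcd c N * x\<close> up to sign; this in turn divides
  \<open>y * x\<close>.\<close>

lemma dvd_mult_if_gcd_dvd:
  fixes c N x y :: int
  assumes "N dvd c * x" "gcd c N dvd y"
  shows "N dvd y * x"
proof -
  have "N dvd gcd (c * x) (N * x)" using assms(1) by simp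
  then have "N dvd gcd c N * x" by (metis gcd_mult_right dvd_abs_iff normalize_int_def gcd.commute mult.commute abs_mult)
  also have "\<dots> dvd y * x" using assms(2) by (intro mult_dvd_mono) auto
  finally show ?thesis .
qed

lemma triangular_system_decouples:
  fixes c :: "nat \<Rightarrow> nat \<Rightarrow> int" and N :: int
  assumes upper: "\<And>i j. j < i \<Longrightarrow> c i j = 0"
    and gcd: "\<And>i j. \<lbrakk>1 \<le> i; i < j; j \<le> k\<rbrakk> \<Longrightarrow> gcd (c j j) N dvd c i j"
  shows "(\<forall>i\<in>{1..k}. N dvd (\<Sum>j=1..k. c i j * x j)) \<longleftrightarrow> (\<forall>j\<in>{1..k}. N dvd c j j * x j)"
    (is "?L \<longleftrightarrow> ?R")
proof
  assume ?R
  have "N dvd c i j * x j" if "i \<in> {1..k}" "j \<in> {1..k}" for i j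
    using dvd_mult_if_gcd_dvd[OF _ gcd[of i j]] \<open>?R\<close> upper[of j i] that
    by (cases i j rule: linorder_cases) auto
  then show ?L by (auto intro: dvd_sum)
next
  assume ?L
  have "N dvd c i i * x i" if "i \<in> {1..k}" for i
    using that
  \<comment> \<open>Induction on \<open>k - i\<close> runs from the last row upwards, so the claim
    is available for all \<open>j > i\<close>. Entries with \<open>j < i\<close> vanish, so every
    summand of row \<open>i\<close> off the diagonal is divisible by \<open>N\<close>.\<close>
  proof (induction "k - i" arbitrary: i rule: less_induct)
    case less
    have "N dvd c i j * x j" if "j \<in> {1..k} - {i}" for j
    proof (cases "j < i")
      case False
      with less.hyps[of j] that less.prems have "N dvd c j j * x j" by auto
      then show ?thesis using gcd[of i j] that False less.prems by (auto intro: dvd_mult_if_gcd_dvd)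
    qed (simp add: upper)
    then have "N dvd (\<Sum>j\<in>{1..k} - {i}. c i j * x j)" by (intro dvd_sum) auto
    moreover have "(\<Sum>j=1..k. c i j * x j) = c i i * x i + (\<Sum>j\<in>{1..k} - {i}. c i j * x j)"
      using less.prems by (intro sum.remove) auto
    ultimately show ?case using \<open>?L\<close> less.prems by (metis dvd_add_left_iff)
  qed
  then show ?R by blast
qed

text \<open>Only the diagonal exponents remain in this description, so the kernels of f and g become
  comparable. A constant term adds one coordinate, which is constrained by the row of ones
  alone.\<close>

lemma cong_kernel_restrict_tri_poly:
  fixes N :: nat and a :: "nat \<Rightarrow> 'a::comm_ring_1" and b :: 'a
  assumes "\<forall>j\<in>{1..n}. 0 < d j j" "k \<le> n" "\<forall>j\<in>{1..n}. a j \<noteq> 0"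
    and gcd: "\<forall>j\<in>{1..n}. \<forall>i\<in>{1..<j}. gcd (d j j) N dvd d i j"
  shows "cong_kernel (int N)
      (aug_degree_mat k (tri_order n (tri_exp d)) (restrict_vars k (tri_poly n a d b))) =
    {v \<in> carrier_vec (k + (if b = 0 then 0 else 1)).
      int N dvd (\<Sum>l<dim_vec v. v $ l) \<and> (\<forall>j\<in>{1..k}. int N dvd int (d j j) * v $ (j - 1))}"
proof -
  define m where "m = k + (if b = 0 then 0 else 1)"
  define Ms where "Ms = map (tri_exp d) [1..<k + 1] @ (if b = 0 then [] else [0])"
  define c where "c i j = int (Poly_Mapping.lookup (tri_exp d j) i)" for i j
  let ?A = "mat (k + 1) m (\<lambda>(i, j). if i = 0 then 1 else int (Poly_Mapping.lookup (Ms ! j) i))"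
  have Ms: "ordered_monomials (tri_order n (tri_exp d)) (restrict_vars k (tri_poly n a d b)) = Ms"
    unfolding Ms_def by (rule ordered_monomials_restrict_tri_poly) (use assms(1-3) in auto)
  have "length Ms = m" by (simp add: Ms_def m_def)
  then have A: "aug_degree_mat k (tri_order n (tri_exp d)) (restrict_vars k (tri_poly n a d b)) = ?A"
    by (simp only: aug_degree_mat_def Ms Let_def)
  have row0: "(?A *\<^sub>v v) $ 0 = (\<Sum>l<dim_vec v. v $ l)" if "v \<in> carrier_vec m" for v
    using that by (simp add: scalar_prod_def atLeast0LessThan)
  have row: "(?A *\<^sub>v v) $ i = (\<Sum>j=1..k. c i j * v $ (j - 1))"
    if "v \<in> carrier_vec m" "i \<in> {1..k}" for v i
  proof -
    have "(?A *\<^sub>v v) $ i = (\<Sum>l<m. int (Poly_Mapping.lookup (Ms ! l) i) * v $ l)"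
      using that by (simp add: scalar_prod_def atLeast0LessThan)
    \<comment> \<open>The column of the constant term, if present, has index \<open>k\<close> and
      only zero exponents.\<close>
    also have "\<dots> = (\<Sum>l<k. int (Poly_Mapping.lookup (Ms ! l) i) * v $ l)"
      by (simp add: m_def Ms_def nth_append del: upt_Suc)
    also have "\<dots> = (\<Sum>l<k. c i (Suc l) * v $ l)"
      by (intro sum.cong) (simp_all add: Ms_def c_def nth_append del: upt_Suc)
    \<comment> \<open>Monomials are numbered from 1 but vector coordinates from 0, hence
      \<open>j - 1\<close>. Rows need no shift, because row 0 is the row of ones.\<close>
    also have "\<dots> = (\<Sum>j=1..k. c i j * v $ (j - 1))"
      by (simp add: sum.atLeast1_atMost_eq)
    finally show ?thesis .
  qed
  have system: "(\<forall>i\<in>{1..k}. int N dvd (\<Sum>j=1..k. c i j * v $ (j - 1))) \<longleftrightarrow>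
      (\<forall>j\<in>{1..k}. int N dvd c j j * v $ (j - 1))" for v
  proof (rule triangular_system_decouples)
    show "gcd (c j j) (int N) dvd c i j" if "1 \<le> i" "i < j" "j \<le> k" for i j
      using gcd that assms(2) by (simp add: c_def lookup_tri_exp)
  qed (simp add: c_def lookup_tri_exp)
  have all_rows: "(\<forall>i<k + 1. P i) \<longleftrightarrow> P 0 \<and> (\<forall>i\<in>{1..k}. P i)" for P :: "nat \<Rightarrow> bool"
    by (auto simp: Ball_def) (metis le_less_Suc_eq less_Suc_eq_le not_less_eq_eq bot_nat_0.extremum_uniqueI)
  have "cong_kernel (int N) ?A = {v \<in> carrier_vec m. int N dvd (\<Sum>l<dim_vec v. v $ l) \<and>
      (\<forall>i\<in>{1..k}. int N dvd (\<Sum>j=1..k. c i j * v $ (j - 1)))}"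
    unfolding cong_kernel_def dim_row_mat dim_col_mat cong_0_iff all_rows
    by (intro Collect_cong conj_cong refl) (auto simp only: row0 row)
  also have "\<dots> = {v \<in> carrier_vec m. int N dvd (\<Sum>l<dim_vec v. v $ l) \<and>
      (\<forall>j\<in>{1..k}. int N dvd int (d j j) * v $ (j - 1))}"
    unfolding system by (simp add: c_def lookup_tri_exp)
  finally show ?thesis by (simp add: A m_def)
qed

section \<open>Unit multiples and the comparison of f with g\<close>

text \<open>A unit modulo \<open>N\<close> is coprime to \<open>N\<close>, so the factor
  \<open>m\<close> can be cancelled from the divisibility.\<close>

lemma dvd_mult_unit_mod_iff:
  assumes "unit_mod N m" "[u = m * w] (mod N)"
  shows "int N dvd int u * x \<longleftrightarrow> int N dvd int w * x"
proof -
  obtain m' where m': "[m * m' = 1] (mod N)" using assms(1) by (auto simp: unit_mod_def)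
  have u: "[int u = int m * int w] (mod int N)"
    using assms(2) by (simp flip: cong_int_iff)
  have "coprime (int m) (int N)"
    using m' by (metis coprime_iff_invertible_int cong_int_iff of_nat_1 of_nat_mult)
  then have "int N dvd int m * (int w * x) \<longleftrightarrow> int N dvd int w * x"
    by (simp add: coprime_dvd_mult_right_iff coprime_commute)
  moreover have "[int u * x = int m * (int w * x)] (mod int N)"
    using cong_mult[OF u cong_refl, of x] by (simp add: mult.assoc)
  ultimately show ?thesis by (simp add: cong_dvd_iff)
qed

theorem theorem5:
  fixes n :: nat and a :: "nat \<Rightarrow> 'a::{field,finite}" and b :: 'a
    and d :: "nat \<Rightarrow> nat \<Rightarrow> nat" and e :: "nat \<Rightarrow> nat" and f g :: "'a mvpoly"
  assumes "n \<ge> 1"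
    and "\<forall>j\<in>{1..n}. a j \<noteq> 0"
    and "\<forall>j\<in>{1..n}. d j j > 0"
    and "\<forall>j\<in>{1..n}. e j > 0"
    and "f = (\<Sum>j=1..n. mconst (a j) * (\<Prod>i=1..j. mvar i ^ d i j)) - mconst b"
    and "g = (\<Sum>j=1..n. mconst (a j) * mvar j ^ e j) - mconst b"
    and "\<forall>j\<in>{1..n}. \<exists>m. unit_mod (CARD('a) - 1) m \<and> [d j j = m * e j] (mod (CARD('a) - 1))"
    and "\<forall>j\<in>{1..n}. \<forall>i\<in>{1..<j}. gcd (d j j) (CARD('a) - 1) dvd d i j"
  shows "totally_star_equiv n (tri_order n (tri_exp d)) f (tri_order n (diag_exp e)) g"
proof -
  let ?N = "CARD('a) - 1"
  have f: "f = tri_poly n a d b" by (simp add: assms(5) tri_poly_def)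
  have g: "g = tri_poly n a (diag_mat e) b" by (simp only: assms(6) diag_poly_eq_tri_poly)
  \<comment> \<open>The gcd condition for g holds because its entries above the diagonal are 0,
    which everything divides.\<close>
  have e: "\<forall>j\<in>{1..n}. 0 < diag_mat e j j"
    and gcd_e: "\<forall>j\<in>{1..n}. \<forall>i\<in>{1..<j}. gcd (diag_mat e j j) ?N dvd diag_mat e i j"
    using assms(4) by auto
  have unit: "int ?N dvd int (d j j) * x \<longleftrightarrow> int ?N dvd int (e j) * x" if "j \<in> {1..n}" for j x
    using assms(7) that dvd_mult_unit_mod_iff by blast
  show ?thesis
    unfolding totally_star_equiv_def star_equiv_def tri_order_diag_exp f g
  proof (intro ballI conjI)
    fix k assume "k \<in> {1..n}"
    then have k: "k \<le> n" by simp
    show "coeff_vector (tri_order n (tri_exp d)) (restrict_vars k (tri_poly n a d b)) =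
        coeff_vector (tri_order n (tri_exp (diag_mat e))) (restrict_vars k (tri_poly n a (diag_mat e) b))"
      by (simp only: coeff_vector_restrict_tri_poly[of n d k a b, OF assms(3) k assms(2)]
          coeff_vector_restrict_tri_poly[of n "diag_mat e" k a b, OF e k assms(2)])
    show "cong_kernel (int ?N)
          (aug_degree_mat k (tri_order n (tri_exp d)) (restrict_vars k (tri_poly n a d b))) =
        cong_kernel (int ?N) (aug_degree_mat k (tri_order n (tri_exp (diag_mat e)))
          (restrict_vars k (tri_poly n a (diag_mat e) b)))"
      unfolding cong_kernel_restrict_tri_poly[of n d k a ?N b, OF assms(3) k assms(2) assms(8)]
        cong_kernel_restrict_tri_poly[of n "diag_mat e" k a ?N b, OF e k assms(2) gcd_e]
      \<comment> \<open>Both kernels have the same dimension and the same row of ones; the diagonal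
        conditions are matched one \<open>j\<close> at a time by \<open>unit\<close>, with
        \<open>k \<le> n\<close> keeping \<open>j\<close> in range.\<close>
      using k unit by (intro Collect_cong conj_cong refl ball_cong) auto
  qed
qed

end
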